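(* We have $$\bigcap_{d\in D}P_{\mathrm{DL}}(d)=\bigcap_{d\in V_{\mathrm{DL}}}P_{\mathrm{DL}}(d)=\overline P_{\mathrm{DL}},$$ where $\overline P_{\mathrm{DL}}$ is the set of all $x\in P_{\mathrm{AP}}$ satisfying $$\sum_{ij\in C}(x_{ij}+x_{ji})-x_{lk}\leq |C|-1\quad \text{for all } C\in\mathcal C_1 \text{ with } |C|\geq 3 \text{ and all } kl\in C,$$ $$x_{ij}+x_{ji}\leq 1\quad \text{for all } ij\in A_1.$$
   Context: Let $n\ge 4$, $N=\{1,\dots,n\}$, $A=\{ij : i,j\in N,\ i\ne j\}$, $N_1=N\setminus\{1\}$, $A_1=\{ij : i,j\in N_1,\ i\neq j\}$. $\mathcal C_1$ is the set of (simple) directed cycles with arcs in $A_1$, each of length at least 2 and identified with its set of arcs; $|C|$ is the number of arcs. $P_{\mathrm{AP}}$ is the set of $x\in[0,1]^A$ with $\sum_{j\neq i}x_{ij}=1$ and $\sum_{j\ne i}x_{ji}=1$ for all $i\in N$. $D=\{d\in\mathbb R_{++}^{A_1} : \sum_{ij\in C}d_{ij}\le 1\ \text{for all } C\in\mathcal C_1\}$, where $\mathbb R_{++}$ denotes the positive reals, and $\overline D$ is the same set with $\mathbb R_{++}$ replaced by the nonnegative reals $\mathbb R_+$. For $d\in\overline D$, $P_{\mathrm{DL}}(d)$ is the projection onto the $x$ variables of $$Q_{\mathrm{DL}}(d)=\{(x,u)\in P_{\mathrm{AP}}\times\mathbb R^{N_1} : u_i-u_j+x_{ij}+(1-d_{ij}-d_{ji})x_{ji}\le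 1-d_{ij}\ \text{for all } ij\in A_1\}.$$ For $kl\in A_1$, $d^{kl}$ is the $kl$-th canonical (unit) vector of $\mathbb R^{A_1}$; $V_{\mathrm{DL}}=\{d^{kl} : kl\in A_1\}\subseteq\overline D$. (The paper writes $\mathbf{Cl}(P_{\mathrm{DL}}(D'))$ for $\bigcap_{d\in D'}P_{\mathrm{DL}}(d)$.) *)

theory Defs
  imports Complex_Main "HOL-Library.FuncSet" "Graph_Theory.Arc_Walk"
begin

text \<open>
  An arc \<open>ij\<close> is the pair \<open>(i, j)\<close>. A vector indexed by a finite set \<open>I\<close> is a function on \<open>I\<close>
  that is \<^const>\<open>undefined\<close> outside \<open>I\<close> (an element of \<open>I \<rightarrow>\<^sub>E UNIV\<close>), so that equality of
  vectors is equality of their components.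
\<close>

type_synonym arc = "nat \<times> nat"

definition nodes :: "nat \<Rightarrow> nat set" where
  "nodes n = {1..n}"

definition nodes1 :: "nat \<Rightarrow> nat set" where
  "nodes1 n = nodes n - {1}"

definition all_arcs :: "nat set \<Rightarrow> arc set" where
  "all_arcs S = {(i, j). i \<in> S \<and> j \<in> S \<and> i \<noteq> j}"

abbreviation A :: "nat \<Rightarrow> arc set" where
  "A n \<equiv> all_arcs (nodes n)"

abbreviation A1 :: "nat \<Rightarrow> arc set" where
  "A1 n \<equiv> all_arcs (nodes1 n)"

definition complete_digraph :: "nat set \<Rightarrow> (nat, arc) pre_digraph" where
  "complete_digraph S = \<lparr>verts = S, arcs = all_arcs S, tail = fst, head = snd\<rparr>"

text \<open>
  A \<^const>\<open>pre_digraph.cycle\<close> is a closed arc walk without repeated vertices, given as a list of arcs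
  with a starting point; passing to \<^const>\<open>set\<close> identifies a cycle with its arcs.
\<close>

definition cycles1 :: "nat \<Rightarrow> arc set set" where
  "cycles1 n = {set p | p. pre_digraph.cycle (complete_digraph (nodes1 n)) p \<and> length p \<ge> 2}"

definition P_AP :: "nat \<Rightarrow> (arc \<Rightarrow> real) set" where
  "P_AP n = {x \<in> A n \<rightarrow>\<^sub>E {0..1}. \<forall>i\<in>nodes n.
     (\<Sum>j\<in>nodes n - {i}. x (i, j)) = 1 \<and> (\<Sum>j\<in>nodes n - {i}. x (j, i)) = 1}"

definition D :: "nat \<Rightarrow> (arc \<Rightarrow> real) set" where
  "D n = {d \<in> A1 n \<rightarrow>\<^sub>E {0<..}. \<forall>C\<in>cycles1 n. (\<Sum>a\<in>C. d a) \<le> 1}"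

definition Q_DL :: "nat \<Rightarrow> (arc \<Rightarrow> real) \<Rightarrow> ((arc \<Rightarrow> real) \<times> (nat \<Rightarrow> real)) set" where
  "Q_DL n d = {(x, u) \<in> P_AP n \<times> (nodes1 n \<rightarrow>\<^sub>E UNIV). \<forall>(i, j)\<in>A1 n.
     u i - u j + x (i, j) + (1 - d (i, j) - d (j, i)) * x (j, i) \<le> 1 - d (i, j)}"

definition P_DL :: "nat \<Rightarrow> (arc \<Rightarrow> real) \<Rightarrow> (arc \<Rightarrow> real) set" where
  "P_DL n d = fst ` Q_DL n d"

definition unit_vec :: "nat \<Rightarrow> arc \<Rightarrow> arc \<Rightarrow> real" where
  "unit_vec n kl = (\<lambda>a\<in>A1 n. if a = kl then 1 else 0)"

definition V_DL :: "nat \<Rightarrow> (arc \<Rightarrow> real) set" where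
  "V_DL n = unit_vec n ` A1 n"

definition P_DL_bar :: "nat \<Rightarrow> (arc \<Rightarrow> real) set" where
  "P_DL_bar n = {x \<in> P_AP n.
     (\<forall>C\<in>cycles1 n. card C \<ge> 3 \<longrightarrow>
        (\<forall>(k, l)\<in>C. (\<Sum>(i, j)\<in>C. x (i, j) + x (j, i)) - x (l, k) \<le> real (card C) - 1)) \<and>
     (\<forall>(i, j)\<in>A1 n. x (i, j) + x (j, i) \<le> 1)}"

end

theory Submission
  imports Defs
begin

text \<open>
  The system that defines \<^const>\<open>Q_DL\<close> asks for a potential \<open>u\<close> that dominates arc weights
  \<open>w\<^sub>d\<close> depending on \<open>x\<close> and affinely on \<open>d\<close>. Such a potential exists exactly when no directed
  cycle has positive weight (lemma \<open>exists_potential_iff\<close>), so \<^const>\<open>P_DL\<close> is the set of all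
  assignment vectors with
  \<open>(\<Sum>ij\<in>C. x\<^sub>i\<^sub>j + x\<^sub>j\<^sub>i - 1) + (\<Sum>ij\<in>C. d\<^sub>i\<^sub>j (1 - x\<^sub>j\<^sub>i) - d\<^sub>j\<^sub>i x\<^sub>j\<^sub>i) \<le> 0\<close>
  for every cycle \<open>C\<close> (lemma \<open>P_DL_iff_cycle_weights\<close>). What remains is to compare these
  inequalities for different \<open>d\<close>.

  If \<open>d\<close> is the unit vector of \<open>kl\<close>, the inequality of a cycle through \<open>kl\<close> of length at least 3 is
  the lifted inequality of \<^const>\<open>P_DL_bar\<close>, because such a cycle does not contain \<open>lk\<close>; the
  inequality of the cycle \<open>{kl, lk}\<close> is \<open>x\<^sub>k\<^sub>l + x\<^sub>l\<^sub>k \<le> 1\<close>. Hence the unit vectors already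
  yield all inequalities of \<^const>\<open>P_DL_bar\<close>.

  Conversely let \<open>d \<ge> 0\<close> satisfy \<open>d(C) \<le> 1\<close> on all cycles. After the terms \<open>d\<^sub>j\<^sub>i x\<^sub>j\<^sub>i\<close> are
  discarded, the inequality of a long cycle \<open>C\<close> is the combination, with multipliers \<open>d\<^sub>k\<^sub>l\<close> for
  \<open>kl \<in> C\<close>, of its lifted inequalities, plus \<open>1 - d(C)\<close> times the sum of \<open>x\<^sub>i\<^sub>j + x\<^sub>j\<^sub>i \<le> 1\<close>
  over \<open>C\<close>; the inequality of a cycle \<open>{kl, lk}\<close> is \<open>2 - d\<^sub>k\<^sub>l - d\<^sub>l\<^sub>k\<close> times
  \<open>x\<^sub>k\<^sub>l + x\<^sub>l\<^sub>k \<le> 1\<close>. So \<^const>\<open>P_DL_bar\<close> lies in \<^const>\<open>P_DL\<close> for every \<open>d\<close> in \<^const>\<open>D\<close>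
  (lemma \<open>P_DL_bar_subset_P_DL\<close>).

  Unit vectors have zero entries, so they are not in \<^const>\<open>D\<close>, but they are limits of points of
  \<^const>\<open>D\<close>: move from a unit vector towards a small constant vector. As the cycle weights are
  affine in \<open>d\<close>, the inequalities for the points of \<^const>\<open>D\<close> pass to the limit (lemma
  \<open>Inter_D_subset_P_DL_unit_vec\<close>), which closes the circle.
\<close>

section \<open>Potentials and cycle weights in a finite digraph\<close>

context wf_digraph
begin

lemma sum_list_potential_along_walk:
  fixes u :: "'a \<Rightarrow> real"
  assumes "awalk s p t"
  shows "(\<Sum>e\<leftarrow>p. u (tail G e) - u (head G e)) = u s - u t"
  using assms by (induction p arbitrary: s) (auto simp: awalk_Cons_iff awalk_Nil_iff)

lemma cycle_weight_nonpos_if_potential: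
  fixes u :: "'a \<Rightarrow> real"
  assumes u: "\<And>e. e \<in> arcs G \<Longrightarrow> u (tail G e) - u (head G e) + w e \<le> 0"
    and "cycle p"
  shows "(\<Sum>e\<leftarrow>p. w e) \<le> 0"
proof -
  obtain s where walk: "awalk s p s"
    using \<open>cycle p\<close> by (auto simp: cycle_def)
  then have "set p \<subseteq> arcs G" by auto
  then have "(\<Sum>e\<leftarrow>p. (u (tail G e) - u (head G e)) + w e) \<le> (\<Sum>e\<leftarrow>p. 0)"
    using u by (intro sum_list_mono) auto
  then show ?thesis
    using sum_list_potential_along_walk[OF walk, of u] by (simp add: sum_list_addf)
qed

end

context fin_digraph
begin

text \<open>
  The potential of a vertex is the maximal weight of a simple path that ends there. Prolonging an
  optimal path by an arc \<open>e\<close> either gives a simple path again, or it closes a cycle; removing the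
  cycle, whose weight is nonpositive, leaves a simple path that is at least as heavy.
\<close>

lemma exists_potential_if_cycle_weights_nonpos:
  fixes w :: "'b \<Rightarrow> real"
  assumes nonpos: "\<And>p. cycle p \<Longrightarrow> (\<Sum>e\<leftarrow>p. w e) \<le> 0"
  shows "\<exists>u :: 'a \<Rightarrow> real. \<forall>e\<in>arcs G. u (tail G e) - u (head G e) + w e \<le> 0"
proof -
  define W where "W j = {(\<Sum>e\<leftarrow>p. w e) | s p. apath s p j}" for j
  have fin: "finite (W j)" for j
  proof (rule finite_subset)
    show "W j \<subseteq> (\<lambda>(s, p, t). \<Sum>e\<leftarrow>p. w e) ` {(s, p, t). apath s p t}"
      by (force simp: W_def)
  qed (use apaths_finite_triple in blast)
  have ne: "W j \<noteq> {}" if "j \<in> verts G" for j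
    using that apath_Nil_iff[of j j] by (auto simp: W_def)
  have "Max (W (tail G e)) + w e \<le> Max (W (head G e))" if e: "e \<in> arcs G" for e
  proof -
    let ?i = "tail G e" and ?j = "head G e"
    have "Max (W ?i) \<in> W ?i"
      using fin ne e by (intro Max_in) auto
    then obtain s p where path: "apath s p ?i" and max: "Max (W ?i) = (\<Sum>e\<leftarrow>p. w e)"
      by (auto simp: W_def)
    then have walk: "awalk s p ?i" and dist: "distinct (awalk_verts s p)"
      by (auto simp: apath_def)
    have "\<exists>c\<in>W ?j. (\<Sum>e\<leftarrow>p. w e) + w e \<le> c"
    proof (cases "?j \<in> set (awalk_verts s p)")
      case False
      have "awalk s (p @ [e]) ?j"
        using walk e by (simp add: awalk_simps)
      moreover from this have "distinct (awalk_verts s (p @ [e]))"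
        using walk dist False by (simp add: awalk_verts_append)
      ultimately have "apath s (p @ [e]) ?j"
        by (simp add: apath_def)
      then have "(\<Sum>e\<leftarrow>p @ [e]. w e) \<in> W ?j"
        unfolding W_def by blast
      then show ?thesis by auto
    next
      case True
      then obtain q r where p: "p = q @ r" and q: "awalk s q ?j" and r: "awalk ?j r ?i"
        using awalk_decomp[OF walk] by blast
      have dist_append: "distinct (awalk_verts s q @ tl (awalk_verts ?j r))"
        using dist awalk_verts_append[of s q r ?i] walk q r by (simp add: p)
      then have "apath s q ?j"
        using q by (simp add: apath_def)
      then have "(\<Sum>e\<leftarrow>q. w e) \<in> W ?j"
        by (auto simp: W_def)
      moreover have "cycle (r @ [e])"
      proof -
        have cyc: "awalk ?j (r @ [e]) ?j"
          using r e by (simp add: awalk_simps)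
        have "?j \<in> set (awalk_verts s q)"
          using q by (metis awalkE last_in_set awalk_verts_non_Nil)
        then have "distinct (tl (awalk_verts ?j r) @ [?j])"
          using dist_append by auto
        moreover have "awalk_verts ?j (r @ [e]) = awalk_verts ?j r @ [?j]"
          using awalk_verts_append[OF cyc] r by simp
        ultimately have "distinct (tl (awalk_verts ?j (r @ [e])))"
          by simp
        then show ?thesis
          using cyc by (auto simp: cycle_def)
      qed
      then have "(\<Sum>e\<leftarrow>r @ [e]. w e) \<le> 0"
        by (rule nonpos)
      ultimately show ?thesis
        by (intro bexI[of _ "\<Sum>e\<leftarrow>q. w e"]) (auto simp: p)
    qed
    then show ?thesis
      using fin max Max_ge order_trans by metis
  qed
  then show ?thesis
    by (intro exI[of _ "\<lambda>j. Max (W j)"]) (auto simp: algebra_simps)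
qed

lemma exists_potential_iff:
  fixes w :: "'b \<Rightarrow> real"
  shows "(\<exists>u :: 'a \<Rightarrow> real. \<forall>e\<in>arcs G. u (tail G e) - u (head G e) + w e \<le> 0) \<longleftrightarrow>
    (\<forall>p. cycle p \<longrightarrow> (\<Sum>e\<leftarrow>p. w e) \<le> 0)"
  using exists_potential_if_cycle_weights_nonpos cycle_weight_nonpos_if_potential by metis

end

section \<open>Cycles of the complete digraph\<close>

lemma verts_complete_digraph [simp]: "verts (complete_digraph S) = S"
  and arcs_complete_digraph [simp]: "arcs (complete_digraph S) = all_arcs S"
  and tail_complete_digraph [simp]: "tail (complete_digraph S) = fst"
  and head_complete_digraph [simp]: "head (complete_digraph S) = snd"
  by (simp_all add: complete_digraph_def)

lemma finite_nodes1: "finite (nodes1 n)"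
  by (simp add: nodes1_def nodes_def)

lemma finite_all_arcs: "finite S \<Longrightarrow> finite (all_arcs S)"
  by (rule finite_subset[of _ "S \<times> S"]) (auto simp: all_arcs_def)

lemma fin_digraph_complete: "finite S \<Longrightarrow> fin_digraph (complete_digraph S)"
  by unfold_locales (auto simp: finite_all_arcs, auto simp: all_arcs_def)

lemma loopfree_digraph_complete: "loopfree_digraph (complete_digraph S)"
  by unfold_locales (auto simp: all_arcs_def)

text \<open>
  Along a cycle every vertex is left exactly once, which is the form in which simplicity is used.
\<close>

lemma cycles1E:
  assumes "C \<in> cycles1 n"
  obtains s p where "C = set p" "pre_digraph.awalk (complete_digraph (nodes1 n)) s p s"
    "distinct (map fst p)" "length p = card C" "card C \<ge> 2"
proof -
  interpret loopfree_digraph "complete_digraph (nodes1 n)"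
    by (rule loopfree_digraph_complete)
  obtain p where C: "C = set p" and p: "cycle p" "length p \<ge> 2"
    using assms by (auto simp: cycles1_def)
  then obtain s where walk: "awalk s p s" and dist: "distinct (tl (awalk_verts s p))"
    and ne: "p \<noteq> []"
    by (auto simp: cycle_def)
  \<comment> \<open>Simplicity is given for the vertices without the first one; as the walk is closed, the first
    one reappears as the last, so the tails are the same vertices in another order.\<close>
  have "fst (hd p) = s" "snd (last p) = s"
    using walk ne by (cases p; auto simp: awalk_def cas_simp)
      (use walk ne in \<open>auto simp: awalk_conv awalk_verts_conv\<close>)
  then have distinct: "distinct (map fst p)"
    using dist ne by (cases p) (auto simp: awalk_verts_conv)
  then have "length p = card C"
    by (simp add: C distinct_card distinct_map)
  then show thesis
    using that[OF C walk distinct] p by simp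
qed

lemma cycles1_subset: "C \<in> cycles1 n \<Longrightarrow> C \<subseteq> A1 n"
  by (elim cycles1E) (auto simp: pre_digraph.awalk_def)

lemma finite_cycles1: "C \<in> cycles1 n \<Longrightarrow> finite C"
  by (elim cycles1E) simp

lemma card_cycles1_le:
  assumes "C \<in> cycles1 n"
  shows "card C \<le> n"
proof -
  obtain p where C: "C = set p" and dist: "distinct (map fst p)" and len: "length p = card C"
    using assms by (rule cycles1E)
  have "fst ` set p \<subseteq> nodes n"
    using cycles1_subset[OF assms] by (auto simp: C all_arcs_def nodes1_def)
  then have "card (fst ` set p) \<le> card (nodes n)"
    by (intro card_mono) (auto simp: nodes_def)
  then show ?thesis
    using distinct_card[OF dist] by (simp add: nodes_def len)
qed

lemma two_cycle_in_cycles1: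
  assumes "(k, l) \<in> A1 n"
  shows "{(k, l), (l, k)} \<in> cycles1 n"
proof -
  interpret loopfree_digraph "complete_digraph (nodes1 n)"
    by (rule loopfree_digraph_complete)
  have "cycle [(k, l), (l, k)]"
    unfolding cycle_def by (intro exI[of _ k])
      (use assms in \<open>auto simp: awalk_simps all_arcs_def\<close>)
  then show ?thesis
    unfolding cycles1_def by (intro CollectI exI[of _ "[(k, l), (l, k)]"]) auto
qed

lemma card_2_cycle:
  assumes "C \<in> cycles1 n" "card C = 2"
  obtains k l where "k \<noteq> l" "C = {(k, l), (l, k)}" "(k, l) \<in> A1 n"
proof -
  interpret loopfree_digraph "complete_digraph (nodes1 n)"
    by (rule loopfree_digraph_complete)
  obtain s p where C: "C = set p" and walk: "awalk s p s" and "length p = card C"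
    using assms(1) by (rule cycles1E)
  then obtain a b where p: "p = [a, b]"
    using assms(2) by (auto simp: length_Suc_conv numeral_2_eq_2)
  have a: "a = (s, snd a)" and b: "b = (snd a, s)" and "a \<in> A1 n"
    using walk by (auto simp: p awalk_simps prod_eq_iff)
  then have "(s, snd a) \<in> A1 n"
    by metis
  moreover have "C = {(s, snd a), (snd a, s)}"
    using a b by (simp add: C p)
  ultimately show thesis
    using that by (auto simp: all_arcs_def)
qed

text \<open>
  Read the cycle from \<open>kl\<close> on. The arc after it leaves \<open>l\<close>, so it is \<open>lk\<close>; an arc after that would
  leave \<open>k\<close> for a second time.
\<close>

lemma cycle_with_opposite_arcs:
  assumes "C \<in> cycles1 n" "(k, l) \<in> C" "(l, k) \<in> C"
  shows "card C = 2"
proof -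
  interpret loopfree_digraph "complete_digraph (nodes1 n)"
    by (rule loopfree_digraph_complete)
  obtain s p where C: "C = set p" and walk: "awalk s p s" and dist: "distinct (map fst p)"
    and len: "length p = card C"
    using assms(1) by (rule cycles1E)
  have "k \<noteq> l"
    using cycles1_subset[OF assms(1)] assms(2) by (auto simp: all_arcs_def)
  obtain q r where p: "p = q @ (k, l) # r"
    using assms(2) C by (auto dest: split_list)
  define t where "t = r @ q"
  have dist_t: "distinct (map fst ((k, l) # t))"
    using dist by (auto simp: p t_def)
  have walk_t: "awalk l t k"
    using walk by (auto simp: p t_def awalk_simps)
  have lk: "(l, k) \<in> set t"
    using assms(3) \<open>k \<noteq> l\<close> by (auto simp: C p t_def)
  then obtain a t' where t: "t = a # t'"
    by (cases t) auto
  have "fst a = l"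
    using walk_t by (simp add: t awalk_simps)
  then have "a = (l, k)"
    using lk dist_t by (auto simp: t image_iff)
  then have "awalk k t' k"
    using walk_t by (simp add: t awalk_simps)
  then have "t' = []"
    using dist_t by (cases t') (auto simp: t awalk_simps)
  then have "length p = 2"
    using t by (simp add: p t_def) (metis One_nat_def add.commute length_append length_Cons list.size(3))
  then show ?thesis
    using len by simp
qed

section \<open>The cycle inequalities of the lifted formulation\<close>

text \<open>
  The constraint for \<open>ij\<close> in \<^const>\<open>Q_DL\<close> says that \<open>u\<^sub>i - u\<^sub>j\<close> plus this weight is at most 0; the
  terms are arranged by their dependence on \<open>d\<close>.
\<close>

definition arc_weight :: "(arc \<Rightarrow> real) \<Rightarrow> (arc \<Rightarrow> real) \<Rightarrow> arc \<Rightarrow> real" where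
  "arc_weight d x = (\<lambda>(i, j).
     (x (i, j) + x (j, i) - 1) + d (i, j) * (1 - x (j, i)) - d (j, i) * x (j, i))"

lemma P_DL_iff_cycle_weights:
  "x \<in> P_DL n d \<longleftrightarrow> x \<in> P_AP n \<and> (\<forall>C\<in>cycles1 n. (\<Sum>a\<in>C. arc_weight d x a) \<le> 0)"
proof -
  interpret fin_digraph "complete_digraph (nodes1 n)"
    by (intro fin_digraph_complete finite_nodes1)
  interpret loopfree_digraph "complete_digraph (nodes1 n)"
    by (rule loopfree_digraph_complete)
  let ?pot = "\<lambda>u. \<forall>e\<in>A1 n. u (fst e) - u (snd e) + arc_weight d x e \<le> (0 :: real)"
  have constr: "(\<forall>(i, j)\<in>A1 n. u i - u j + x (i, j) + (1 - d (i, j) - d (j, i)) * x (j, i)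
      \<le> 1 - d (i, j)) \<longleftrightarrow> ?pot u" for u
    by (auto simp: arc_weight_def algebra_simps)
  \<comment> \<open>Restricting a potential to the nodes makes it an element of the extensional function
    space over which \<^const>\<open>Q_DL\<close> ranges.\<close>
  have restr: "?pot (restrict u (nodes1 n)) \<longleftrightarrow> ?pot u" for u
    by (intro ball_cong) (auto simp: all_arcs_def)
  have "x \<in> P_DL n d \<longleftrightarrow> (\<exists>u. (x, u) \<in> Q_DL n d)"
    by (force simp: P_DL_def)
  also have "\<dots> \<longleftrightarrow> x \<in> P_AP n \<and> (\<exists>u\<in>nodes1 n \<rightarrow>\<^sub>E UNIV. ?pot u)"
    by (auto simp only: Q_DL_def mem_Collect_eq prod.case mem_Sigma_iff constr)
  also have "(\<exists>u\<in>nodes1 n \<rightarrow>\<^sub>E UNIV. ?pot u) \<longleftrightarrow> (\<exists>u. ?pot u)"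
  proof
    assume "\<exists>u. ?pot u"
    then obtain u where "?pot u" ..
    then show "\<exists>u\<in>nodes1 n \<rightarrow>\<^sub>E UNIV. ?pot u"
      using restr[of u] by (intro bexI[of _ "restrict u (nodes1 n)"]) (blast, simp)
  qed blast
  also have "\<dots> \<longleftrightarrow> (\<forall>p. cycle p \<longrightarrow> (\<Sum>e\<leftarrow>p. arc_weight d x e) \<le> 0)"
    using exists_potential_iff[of "arc_weight d x"] by simp
  also have "\<dots> \<longleftrightarrow> (\<forall>p. cycle p \<longrightarrow> (\<Sum>a\<in>set p. arc_weight d x a) \<le> 0)"
    by (metis cycle_conv sum_list_distinct_conv_sum_set)
  also have "\<dots> \<longleftrightarrow> (\<forall>C\<in>cycles1 n. (\<Sum>a\<in>C. arc_weight d x a) \<le> 0)"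
    unfolding cycles1_def using cycle_digraph_conv by blast
  finally show ?thesis .
qed

lemma P_AP_nonneg:
  assumes "x \<in> P_AP n" "(i, j) \<in> A1 n"
  shows "0 \<le> x (i, j)"
proof -
  have "(i, j) \<in> A n"
    using assms(2) by (auto simp: all_arcs_def nodes1_def)
  then show ?thesis
    using assms(1) by (auto simp: P_AP_def)
qed

lemma A1_swap: "(i, j) \<in> A1 n \<Longrightarrow> (j, i) \<in> A1 n"
  by (auto simp: all_arcs_def)

lemma P_DL_bar_subset_P_DL:
  assumes nonneg: "\<And>a. a \<in> A1 n \<Longrightarrow> 0 \<le> d a"
    and cyc: "\<And>C. C \<in> cycles1 n \<Longrightarrow> (\<Sum>a\<in>C. d a) \<le> 1"
  shows "P_DL_bar n \<subseteq> P_DL n d"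
proof
  fix x assume x: "x \<in> P_DL_bar n"
  then have ap: "x \<in> P_AP n"
    and pair: "\<And>i j. (i, j) \<in> A1 n \<Longrightarrow> x (i, j) + x (j, i) - 1 \<le> 0"
    and lifted: "\<And>C k l. C \<in> cycles1 n \<Longrightarrow> card C \<ge> 3 \<Longrightarrow> (k, l) \<in> C \<Longrightarrow>
      (\<Sum>(i, j)\<in>C. x (i, j) + x (j, i)) - x (l, k) \<le> real (card C) - 1"
    by (auto simp: P_DL_bar_def)
  have "(\<Sum>a\<in>C. arc_weight d x a) \<le> 0" if C: "C \<in> cycles1 n" for C
  proof (cases "card C = 2")
    case True
    then obtain k l where kl: "k \<noteq> l" "C = {(k, l), (l, k)}" "(k, l) \<in> A1 n"
      using C card_2_cycle by metis
    have "(\<Sum>a\<in>C. arc_weight d x a) =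
        (2 - (d (k, l) + d (l, k))) * (x (k, l) + x (l, k) - 1)"
      using kl(1) by (simp add: kl(2) arc_weight_def algebra_simps)
    also have "\<dots> \<le> 0"
      using cyc[OF C] kl pair[OF kl(3)] by (intro mult_nonneg_nonpos) auto
    finally show ?thesis .
  next
    case False
    then have "card C \<ge> 3"
      using C by (metis cycles1E le_neq_implies_less numeral_2_eq_2 numeral_3_eq_3 Suc_leI)
    \<comment> \<open>With this \<open>S\<close> the lifted inequality for \<open>kl\<close> reads \<open>1 - x\<^sub>l\<^sub>k \<le> - S\<close>, which bounds
      every coefficient of \<open>d\<close> in the cycle weight by the same number.\<close>
    define S where "S = (\<Sum>(i, j)\<in>C. x (i, j) + x (j, i) - 1)"
    have S: "S = (\<Sum>(i, j)\<in>C. x (i, j) + x (j, i)) - real (card C)"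
      by (simp add: S_def case_prod_beta sum_subtractf)
    have "S \<le> 0"
      unfolding S_def using pair cycles1_subset[OF C] by (intro sum_nonpos) auto
    have "(\<Sum>a\<in>C. arc_weight d x a) \<le>
        (\<Sum>(i, j)\<in>C. (x (i, j) + x (j, i) - 1) + d (i, j) * (1 - x (j, i)))"
    proof (rule sum_mono)
      fix a assume "a \<in> C"
      then have "a \<in> A1 n"
        using cycles1_subset[OF C] by blast
      then have "0 \<le> d (snd a, fst a) * x (snd a, fst a)"
        using nonneg P_AP_nonneg[OF ap] A1_swap[of "fst a" "snd a" n]
        by (intro mult_nonneg_nonneg) auto
      then show "arc_weight d x a \<le>
          (case a of (i, j) \<Rightarrow> (x (i, j) + x (j, i) - 1) + d (i, j) * (1 - x (j, i)))"
        by (simp add: arc_weight_def case_prod_beta)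
    qed
    also have "\<dots> = S + (\<Sum>(k, l)\<in>C. d (k, l) * (1 - x (l, k)))"
      by (simp add: S_def case_prod_beta sum.distrib)
    also have "\<dots> \<le> S + (\<Sum>(k, l)\<in>C. d (k, l) * (- S))"
      using lifted[OF C \<open>card C \<ge> 3\<close>] nonneg cycles1_subset[OF C] S
      by (intro add_left_mono sum_mono) (fastforce intro!: mult_left_mono)
    also have "\<dots> = (1 - (\<Sum>a\<in>C. d a)) * S"
      by (simp add: case_prod_beta sum_negf sum_distrib_left algebra_simps)
    also have "\<dots> \<le> 0"
      using cyc[OF C] \<open>S \<le> 0\<close> by (intro mult_nonneg_nonpos) auto
    finally show ?thesis .
  qed
  then show "x \<in> P_DL n d"
    using ap by (simp add: P_DL_iff_cycle_weights)
qed

section \<open>Unit vectors\<close>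

lemma unit_vec_nonneg: "a \<in> A1 n \<Longrightarrow> 0 \<le> unit_vec n kl a"
  by (simp add: unit_vec_def)

lemma sum_unit_vec:
  assumes "C \<in> cycles1 n"
  shows "(\<Sum>a\<in>C. unit_vec n kl a) = (if kl \<in> C then 1 else 0)"
proof -
  have "(\<Sum>a\<in>C. unit_vec n kl a) = (\<Sum>a\<in>C. if a = kl then 1 else 0)"
    using cycles1_subset[OF assms] by (intro sum.cong) (auto simp: unit_vec_def)
  then show ?thesis
    using finite_cycles1[OF assms] by simp
qed

lemma Inter_V_DL_subset_P_DL_bar:
  assumes "A1 n \<noteq> {}"
  shows "(\<Inter>d\<in>V_DL n. P_DL n d) \<subseteq> P_DL_bar n"
proof
  fix x assume x: "x \<in> (\<Inter>d\<in>V_DL n. P_DL n d)"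
  then have ap: "x \<in> P_AP n"
    using assms by (auto simp: V_DL_def P_DL_iff_cycle_weights)
  have cyc: "(\<Sum>a\<in>C. arc_weight (unit_vec n kl) x a) \<le> 0" if "kl \<in> A1 n" "C \<in> cycles1 n" for kl C
    using x that by (auto simp: V_DL_def P_DL_iff_cycle_weights)
  have "x (k, l) + x (l, k) \<le> 1" if kl: "(k, l) \<in> A1 n" for k l
  proof -
    have "k \<noteq> l"
      using kl by (auto simp: all_arcs_def)
    then show ?thesis
      using cyc[OF kl two_cycle_in_cycles1[OF kl]] kl A1_swap[OF kl]
      by (simp add: arc_weight_def unit_vec_def)
  qed
  moreover have "(\<Sum>(i, j)\<in>C. x (i, j) + x (j, i)) - x (l, k) \<le> real (card C) - 1"
    if C: "C \<in> cycles1 n" "card C \<ge> 3" and kl: "(k, l) \<in> C" for C k l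
  proof -
    let ?d = "unit_vec n (k, l)"
    have "(l, k) \<notin> C"
      using cycle_with_opposite_arcs[OF C(1) kl] C(2) by auto
    have "arc_weight ?d x (i, j) =
        x (i, j) + x (j, i) - 1 + (if (i, j) = (k, l) then 1 - x (l, k) else 0)"
      if ij: "(i, j) \<in> C" for i j
    proof -
      have "(i, j) \<in> A1 n" "(j, i) \<in> A1 n"
        using ij cycles1_subset[OF C(1)] A1_swap by blast+
      moreover have "(j, i) \<noteq> (k, l)"
        using ij \<open>(l, k) \<notin> C\<close> by blast
      ultimately have "?d (i, j) = (if (i, j) = (k, l) then 1 else 0)" "?d (j, i) = 0"
        unfolding unit_vec_def by (simp_all only: restrict_apply' if_False)
      then show ?thesis
        by (auto simp: arc_weight_def)
    qed
    then have "(\<Sum>a\<in>C. arc_weight ?d x a) = (\<Sum>a\<in>C. x (fst a, snd a) + x (snd a, fst a) - 1 +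
        (if a = (k, l) then 1 - x (l, k) else 0))"
      by (intro sum.cong) (auto split: if_splits)
    also have "\<dots> = (\<Sum>(i, j)\<in>C. x (i, j) + x (j, i)) - real (card C) + (1 - x (l, k))"
      using kl finite_cycles1[OF C(1)] by (simp add: sum.distrib sum_subtractf case_prod_beta)
    finally show ?thesis
      using cyc[OF _ C(1), of "(k, l)"] kl cycles1_subset[OF C(1)] by auto
  qed
  ultimately show "x \<in> P_DL_bar n"
    using ap by (auto simp: P_DL_bar_def)
qed

section \<open>Unit vectors as limits of positive vectors\<close>

text \<open>
  The constant vector \<open>1/n\<close> is admissible because a cycle has at most \<open>n\<close> arcs; mixing it into the
  unit vector makes all entries positive.
\<close>

definition shifted_unit_vec :: "nat \<Rightarrow> arc \<Rightarrow> real \<Rightarrow> arc \<Rightarrow> real" where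
  "shifted_unit_vec n kl t = (\<lambda>a\<in>A1 n. (1 - t) * unit_vec n kl a + t * (1 / real n))"

lemma shifted_unit_vec_in_D:
  assumes "0 < t" "t \<le> 1" "0 < n"
  shows "shifted_unit_vec n kl t \<in> D n"
proof -
  have "0 < shifted_unit_vec n kl t a" if "a \<in> A1 n" for a
    using assms that unit_vec_nonneg[OF that, of kl]
    by (simp add: shifted_unit_vec_def add_nonneg_pos)
  moreover have "(\<Sum>a\<in>C. shifted_unit_vec n kl t a) \<le> 1" if C: "C \<in> cycles1 n" for C
  proof -
    have "(\<Sum>a\<in>C. shifted_unit_vec n kl t a) =
        (\<Sum>a\<in>C. (1 - t) * unit_vec n kl a + t * (1 / real n))"
      using cycles1_subset[OF C] by (intro sum.cong) (auto simp: shifted_unit_vec_def)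
    also have "\<dots> = (1 - t) * (\<Sum>a\<in>C. unit_vec n kl a) + t * (real (card C) / real n)"
      by (simp add: sum.distrib sum_distrib_left)
    also have "\<dots> \<le> (1 - t) * 1 + t * 1"
      using assms card_cycles1_le[OF C] sum_unit_vec[OF C, of kl]
      by (intro add_mono mult_left_mono) auto
    finally show ?thesis by simp
  qed
  ultimately show ?thesis
    by (auto simp: D_def shifted_unit_vec_def)
qed

lemma sum_arc_weight_shifted_unit_vec:
  assumes "C \<in> cycles1 n"
  shows "(\<Sum>a\<in>C. arc_weight (shifted_unit_vec n kl t) x a) =
    (1 - t) * (\<Sum>a\<in>C. arc_weight (unit_vec n kl) x a) +
    t * (\<Sum>a\<in>C. arc_weight (\<lambda>_. 1 / real n) x a)"
proof -
  have "(\<Sum>a\<in>C. arc_weight (shifted_unit_vec n kl t) x a) = (\<Sum>a\<in>C.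
      (1 - t) * arc_weight (unit_vec n kl) x a + t * arc_weight (\<lambda>_. 1 / real n) x a)"
  proof (rule sum.cong)
    fix a assume "a \<in> C"
    moreover obtain i j where a: "a = (i, j)"
      by fastforce
    ultimately have "(i, j) \<in> A1 n" "(j, i) \<in> A1 n"
      using cycles1_subset[OF assms] A1_swap by blast+
    then show "arc_weight (shifted_unit_vec n kl t) x a =
        (1 - t) * arc_weight (unit_vec n kl) x a + t * arc_weight (\<lambda>_. 1 / real n) x a"
      by (simp add: a arc_weight_def shifted_unit_vec_def algebra_simps)
  qed simp
  then show ?thesis
    by (simp add: sum.distrib sum_distrib_left)
qed

lemma nonpos_if_segment_nonpos:
  fixes a b :: real
  assumes "\<And>t. 0 < t \<Longrightarrow> t \<le> 1 \<Longrightarrow> (1 - t) * a + t * b \<le> 0"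
  shows "a \<le> 0"
proof (rule tendsto_upperbound)
  show "((\<lambda>t. (1 - t) * a + t * b) \<longlongrightarrow> a) (at_right 0)"
    by (auto intro!: tendsto_eq_intros)
  show "\<forall>\<^sub>F t in at_right 0. (1 - t) * a + t * b \<le> 0"
    using assms by (auto simp: eventually_at_right[of 0 1] intro!: exI[of _ 1])
qed simp

lemma Inter_D_subset_P_DL_unit_vec:
  assumes "0 < n"
  shows "(\<Inter>d\<in>D n. P_DL n d) \<subseteq> P_DL n (unit_vec n kl)"
proof
  fix x assume x: "x \<in> (\<Inter>d\<in>D n. P_DL n d)"
  then have shifted: "x \<in> P_DL n (shifted_unit_vec n kl t)" if "0 < t" "t \<le> 1" for t
    using shifted_unit_vec_in_D[OF that assms] by blast
  have "(\<Sum>a\<in>C. arc_weight (unit_vec n kl) x a) \<le> 0" if C: "C \<in> cycles1 n" for C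
  proof (rule nonpos_if_segment_nonpos)
    fix t :: real assume "0 < t" "t \<le> 1"
    then show "(1 - t) * (\<Sum>a\<in>C. arc_weight (unit_vec n kl) x a) +
        t * (\<Sum>a\<in>C. arc_weight (\<lambda>_. 1 / real n) x a) \<le> 0"
      using shifted C by (simp add: P_DL_iff_cycle_weights sum_arc_weight_shifted_unit_vec)
  qed
  \<comment> \<open>At \<open>t = 1\<close> the hypothesis also provides membership in \<^const>\<open>P_AP\<close>.\<close>
  then show "x \<in> P_DL n (unit_vec n kl)"
    using shifted[of 1] by (simp add: P_DL_iff_cycle_weights)
qed

theorem theorem24:
  fixes n :: nat
  assumes "n \<ge> 4"
  shows "(\<Inter>d\<in>D n. P_DL n d) = (\<Inter>d\<in>V_DL n. P_DL n d) \<and>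
         (\<Inter>d\<in>V_DL n. P_DL n d) = P_DL_bar n"
proof -
  \<comment> \<open>There is an arc, so the intersection over the unit vectors is not the universal set.\<close>
  have "(2, 3) \<in> A1 n"
    using assms by (simp add: all_arcs_def nodes1_def nodes_def)
  then have "(\<Inter>d\<in>V_DL n. P_DL n d) \<subseteq> P_DL_bar n"
    by (intro Inter_V_DL_subset_P_DL_bar) blast
  moreover have "P_DL_bar n \<subseteq> (\<Inter>d\<in>D n. P_DL n d)"
  proof (rule INT_greatest, rule P_DL_bar_subset_P_DL)
    fix d a assume "d \<in> D n" "a \<in> A1 n"
    then show "0 \<le> d a"
      by (auto simp: D_def PiE_iff intro: less_imp_le)
  qed (auto simp: D_def)
  moreover have "(\<Inter>d\<in>D n. P_DL n d) \<subseteq> (\<Inter>d\<in>V_DL n. P_DL n d)"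
  proof (rule INT_greatest)
    fix d assume "d \<in> V_DL n"
    then obtain kl where "d = unit_vec n kl"
      by (auto simp: V_DL_def)
    then show "(\<Inter>d\<in>D n. P_DL n d) \<subseteq> P_DL n d"
      using Inter_D_subset_P_DL_unit_vec[of n kl] assms by simp
  qed
  ultimately show ?thesis
    by blast
qed

end
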